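(* Let $P_n$ denote the path on $n$ labeled vertices. Then $\mathrm{ic}(P_1)=2$ and $\mathrm{ic}(P_n)=2F_{n-1}$ for every integer $n\geq 2$, where $F_k$ is the $k$-th Fibonacci number ($F_1=F_2=1$, $F_k=F_{k-1}+F_{k-2}$ for $k\ge 3$).
   Context: Let $G=(V,E)$ be a finite labeled graph. A coloring of $G$ is an arbitrary map $\mathcal{C}: V \to \{\text{black},\text{white}\}$. An edge is balanced if its endpoints have different colors. For a vertex $v$, $\mathrm{mix}(v)$ is the number of balanced edges incident to $v$. A vertex $v$ is integrated if $\mathrm{mix}(v)\geq \frac12\deg(v)$, and $\mathcal{C}$ is integrated if every vertex is integrated. $\mathrm{ic}(G)$ is the number of integrated colorings of $G$. The path $P_n$ has vertices $1,\dots,n$ and edges $\{i,i+1\}$ for $1\le i\le n-1$. *)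

theory Defs
  imports Complex_Main "HOL-Library.FuncSet" "HOL-Number_Theory.Fib"
begin

text \<open>
  A graph is a vertex set \<open>V\<close> together with a set \<open>E\<close> of edges, each edge being the
  two-element set of its endpoints.
\<close>

definition finite_graph :: "'a set \<Rightarrow> 'a set set \<Rightarrow> bool" where
  "finite_graph V E \<longleftrightarrow> finite V \<and> (\<forall>e\<in>E. e \<subseteq> V \<and> card e = 2)"

definition incident_edges :: "'a set set \<Rightarrow> 'a \<Rightarrow> 'a set set" where
  "incident_edges E v = {e \<in> E. v \<in> e}"

definition deg :: "'a set set \<Rightarrow> 'a \<Rightarrow> nat" where
  "deg E v = card (incident_edges E v)"

datatype color = Black | White

text \<open>
  Maps with domain \<open>V\<close> are represented extensionally (\<open>undefined\<close> outside \<open>V\<close>), so that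
  distinct elements of \<open>colorings V\<close> are distinct maps on \<open>V\<close> and counting is meaningful.
\<close>

definition colorings :: "'a set \<Rightarrow> ('a \<Rightarrow> color) set" where
  "colorings V = V \<rightarrow>\<^sub>E {Black, White}"

definition balanced :: "('a \<Rightarrow> color) \<Rightarrow> 'a set \<Rightarrow> bool" where
  "balanced C e \<longleftrightarrow> (\<exists>u w. e = {u, w} \<and> C u \<noteq> C w)"

definition mix :: "'a set set \<Rightarrow> ('a \<Rightarrow> color) \<Rightarrow> 'a \<Rightarrow> nat" where
  "mix E C v = card {e \<in> incident_edges E v. balanced C e}"

definition integrated_vertex :: "'a set set \<Rightarrow> ('a \<Rightarrow> color) \<Rightarrow> 'a \<Rightarrow> bool" where
  "integrated_vertex E C v \<longleftrightarrow> real (mix E C v) \<ge> 1 / 2 * real (deg E v)"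

definition integrated :: "'a set \<Rightarrow> 'a set set \<Rightarrow> ('a \<Rightarrow> color) \<Rightarrow> bool" where
  "integrated V E C \<longleftrightarrow> (\<forall>v\<in>V. integrated_vertex E C v)"

definition ic :: "'a set \<Rightarrow> 'a set set \<Rightarrow> nat" where
  "ic V E = card {C \<in> colorings V. integrated V E C}"

definition path_verts :: "nat \<Rightarrow> nat set" where
  "path_verts n = {1..n}"

definition path_edges :: "nat \<Rightarrow> nat set set" where
  "path_edges n = {{i, i + 1} | i. 1 \<le> i \<and> i \<le> n - 1}"

lemma finite_graph_path: "finite_graph (path_verts n) (path_edges n)"
  by (auto simp: finite_graph_def path_verts_def path_edges_def)

text \<open>
  The library's \<open>fib\<close> starts at \<open>fib 0 = 0\<close>; from index 1 on it is the sequence with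
  \<open>F\<^sub>1 = F\<^sub>2 = 1\<close>.
\<close>

lemma fib_convention:
  "fib 1 = 1" "fib 2 = 1" "k \<ge> 3 \<Longrightarrow> fib k = fib (k - 1) + fib (k - 2)"
proof -
  show "fib 1 = 1" "fib 2 = 1" by (simp_all add: numeral_2_eq_2)
  assume "k \<ge> 3"
  then obtain m where "k = Suc (Suc m)" by (metis Suc_le_D numeral_3_eq_3 Suc_le_mono)
  then show "fib k = fib (k - 1) + fib (k - 2)" by simp
qed

end

theory Submission
  imports Defs
begin

text \<open>
  A path with at least two vertices has two vertices of degree 1 and all others of degree 2, so a
  coloring is integrated exactly when both end edges are balanced and no two consecutive edges
  are unbalanced (\<open>integrated_path_iff\<close>).

  In such a coloring of the path on \<open>m + 4\<close> vertices the last edge is balanced, so the last color is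
  forced by the one before it. If the penultimate edge is balanced too, deleting the last vertex
  leaves an integrated coloring. If it is unbalanced, the edge before it must be balanced, so deleting
  the last two vertices leaves an integrated coloring. Both deletions can be undone in
  exactly one way (\<open>card_forced_last_color\<close>), so the counts satisfy the Fibonacci recurrence
  (\<open>path_condition_rec\<close>), and they start with 2 for two and for three vertices.
\<close>

section \<open>Integrated colorings of a path\<close>

lemma balanced_doubleton [simp]: "balanced C {u, w} \<longleftrightarrow> C u \<noteq> C w"
  unfolding balanced_def by (metis doubleton_eq_iff)

lemma incident_path_edges:
  assumes "v \<in> path_verts n"
  shows "incident_edges (path_edges n) v =
    (if v > 1 then {{v - 1, v}} else {}) \<union> (if v < n then {{v, Suc v}} else {})"
proof (rule set_eqI)
  fix e
  have "e \<in> incident_edges (path_edges n) v \<longleftrightarrow>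
      (\<exists>i. e = {i, Suc i} \<and> 1 \<le> i \<and> i \<le> n - 1 \<and> (i = v - 1 \<or> i = v))"
    using assms by (auto simp: incident_edges_def path_edges_def path_verts_def)
  also have "\<dots> \<longleftrightarrow> e \<in> (if v > 1 then {{v - 1, v}} else {}) \<union> (if v < n then {{v, Suc v}} else {})"
    using assms by (auto simp: path_verts_def)
  finally show "e \<in> incident_edges (path_edges n) v \<longleftrightarrow>
    e \<in> (if v > 1 then {{v - 1, v}} else {}) \<union> (if v < n then {{v, Suc v}} else {})" .
qed

lemma integrated_vertex_path_iff:
  assumes "v \<in> path_verts n" and "n \<ge> 2"
  shows "integrated_vertex (path_edges n) C v \<longleftrightarrow>
    (v > 1 \<and> C (v - 1) \<noteq> C v) \<or> (v < n \<and> C v \<noteq> C (Suc v))"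
proof -
  have mix: "mix (path_edges n) C v =
      card ((if v > 1 \<and> C (v - 1) \<noteq> C v then {{v - 1, v}} else {}) \<union>
        (if v < n \<and> C v \<noteq> C (Suc v) then {{v, Suc v}} else {}))"
    unfolding mix_def incident_path_edges[OF assms(1)] by (rule arg_cong[where f = card]) auto
  have deg: "deg (path_edges n) v =
      card ((if v > 1 then {{v - 1, v}} else {}) \<union> (if v < n then {{v, Suc v}} else {}))"
    unfolding deg_def incident_path_edges[OF assms(1)] ..
  have "{v - 1, v} \<noteq> {v, Suc v}"
    by (auto simp: doubleton_eq_iff)
  then show ?thesis
    using assms unfolding integrated_vertex_def mix deg by (auto simp: path_verts_def)
qed

text \<open>
  The condition is stated for the path on \<open>m + 2\<close> vertices; \<open>v\<close>, \<open>v + 1\<close>, \<open>v + 2\<close> run through the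
  triples of consecutive vertices.
\<close>

definition path_condition :: "nat \<Rightarrow> (nat \<Rightarrow> color) \<Rightarrow> bool" where
  "path_condition m C \<longleftrightarrow> C 1 \<noteq> C 2 \<and> C (m + 1) \<noteq> C (m + 2) \<and>
    (\<forall>v\<in>{1..m}. C v \<noteq> C (v + 1) \<or> C (v + 1) \<noteq> C (v + 2))"

lemma integrated_path_iff:
  "integrated (path_verts (m + 2)) (path_edges (m + 2)) C \<longleftrightarrow> path_condition m C"
proof -
  have split: "path_verts (m + 2) = insert 1 (insert (m + 2) (Suc ` {1..m}))"
    unfolding path_verts_def image_Suc_atLeastAtMost by auto
  have iff: "integrated_vertex (path_edges (m + 2)) C v \<longleftrightarrow>
      (v > 1 \<and> C (v - 1) \<noteq> C v) \<or> (v < m + 2 \<and> C v \<noteq> C (Suc v))"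
    if "v \<in> path_verts (m + 2)" for v
    using integrated_vertex_path_iff[OF that] by simp
  have "integrated (path_verts (m + 2)) (path_edges (m + 2)) C \<longleftrightarrow>
      (\<forall>v\<in>path_verts (m + 2). (v > 1 \<and> C (v - 1) \<noteq> C v) \<or> (v < m + 2 \<and> C v \<noteq> C (Suc v)))"
    unfolding integrated_def using iff by blast
  also have "\<dots> \<longleftrightarrow> path_condition m C"
    unfolding split path_condition_def
    by (auto simp: numeral_2_eq_2 simp del: image_Suc_atLeastAtMost)
  finally show ?thesis .
qed

lemma path_condition_cong:
  assumes "\<And>v. v \<in> {1..m + 2} \<Longrightarrow> C v = D v"
  shows "path_condition m C \<longleftrightarrow> path_condition m D"
  using assms by (auto simp: path_condition_def)

section \<open>Deleting and restoring the last vertex\<close>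

fun opposite :: "color \<Rightarrow> color" where
  "opposite Black = White"
| "opposite White = Black"

lemma neq_iff_opposite: "c \<noteq> d \<longleftrightarrow> d = opposite c"
  by (cases c; cases d) auto

lemma colorings_iff: "C \<in> colorings V \<longleftrightarrow> C \<in> extensional V"
  unfolding colorings_def PiE_iff using color.exhaust by blast

lemma finite_colorings: "finite V \<Longrightarrow> finite (colorings V)"
  unfolding colorings_def by (simp add: finite_PiE)

text \<open>
  When the last color is a function of the color before it, restriction to the first \<open>n\<close> vertices
  loses no information, and it is onto because the function prescribes how to extend. The
  function is \<open>opposite\<close> for a balanced last edge and \<open>id\<close> for an unbalanced one.
\<close>

lemma card_forced_last_color:
  assumes local: "\<And>C D. (\<And>v. v \<in> {1..n} \<Longrightarrow> C v = D v) \<Longrightarrow> P C \<longleftrightarrow> P D"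
    and "n \<ge> 1"
  shows "card {C \<in> colorings {1..Suc n}. C (Suc n) = f (C n) \<and> P C} =
    card {C \<in> colorings {1..n}. P C}"
proof (rule bij_betw_same_card)
  let ?A = "{C \<in> colorings {1..Suc n}. C (Suc n) = f (C n) \<and> P C}"
  let ?B = "{C \<in> colorings {1..n}. P C}"
  let ?extend = "\<lambda>C. C(Suc n := f (C n))"
  have restrict: "P (restrict C {1..n}) \<longleftrightarrow> P C" for C
    by (rule local) simp
  have extend: "P (?extend C) \<longleftrightarrow> P C" for C
    by (rule local) simp
  show "bij_betw (\<lambda>C. restrict C {1..n}) ?A ?B"
  proof (rule bij_betwI[where g = ?extend])
    show "(\<lambda>C. restrict C {1..n}) \<in> ?A \<rightarrow> ?B"
      by (auto simp: restrict[simplified] colorings_iff)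
    show "?extend \<in> ?B \<rightarrow> ?A"
      using \<open>n \<ge> 1\<close> extend by (auto simp: colorings_iff extensional_def)
    show "?extend (restrict C {1..n}) = C" if "C \<in> ?A" for C
      using that \<open>n \<ge> 1\<close> by (auto simp: colorings_iff extensional_def fun_eq_iff)
    show "restrict (?extend C) {1..n} = C" if "C \<in> ?B" for C
      using that by (auto simp: colorings_iff extensional_def fun_eq_iff)
  qed
qed

section \<open>The Fibonacci recurrence\<close>

text \<open>
  The disjuncts distinguish whether the edge \<open>{m + 2, m + 3}\<close> before the last one is balanced. If it
  is not, the vertex \<open>m + 2\<close> needs its other edge balanced, and this makes it a correct last
  vertex of the shorter path. That other edge exists only from four vertices on: deleting two
  vertices of three would leave a single vertex, and repeating its color on the second vertex
  makes the first edge unbalanced. Hence the recurrence needs both two and three vertices as base cases.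
\<close>

lemma path_condition_rec:
  "path_condition (m + 2) C \<longleftrightarrow> C (m + 4) = opposite (C (m + 3)) \<and>
    (path_condition (m + 1) C \<or> (C (m + 3) = C (m + 2) \<and> path_condition m C))"
proof -
  have "{1..m + 2} = insert (m + 2) (insert (m + 1) {1..m})" "{1..m + 1} = insert (m + 1) {1..m}"
    by auto
  then show ?thesis
    unfolding path_condition_def neq_iff_opposite[symmetric]
    by (auto simp: eval_nat_numeral)
qed

definition path_count :: "nat \<Rightarrow> nat" where
  "path_count m = card {C \<in> colorings {1..m + 2}. path_condition m C}"

lemma ic_path_eq: "ic (path_verts (m + 2)) (path_edges (m + 2)) = path_count m"
  unfolding ic_def path_count_def integrated_path_iff by (simp add: path_verts_def)

lemma ic_path_1: "ic (path_verts 1) (path_edges 1) = 2"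
proof -
  have "integrated (path_verts 1) (path_edges 1) C" for C
    by (auto simp: integrated_def integrated_vertex_def deg_def incident_edges_def path_edges_def)
  then show ?thesis
    by (simp add: ic_def path_verts_def colorings_def card_PiE)
qed

lemma path_count_0: "path_count 0 = 2"
proof -
  have "{C \<in> colorings {1..2}. path_condition 0 C} =
      {C \<in> colorings {1..Suc 1}. C (Suc 1) = opposite (C 1) \<and> True}"
    by (auto simp: path_condition_def neq_iff_opposite[symmetric] eval_nat_numeral)
  then have "path_count 0 = card {C \<in> colorings {1..Suc 1}. C (Suc 1) = opposite (C 1) \<and> True}"
    unfolding path_count_def by (simp only: add_0)
  also have "\<dots> = card {C \<in> colorings {1..1::nat}. True}"
    by (rule card_forced_last_color) simp_all
  also have "\<dots> = 2"
    by (simp add: colorings_def card_PiE)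
  finally show ?thesis .
qed

lemma path_count_1: "path_count 1 = 2"
proof -
  have "{C \<in> colorings {1..1 + 2}. path_condition 1 C} =
      {C \<in> colorings {1..Suc 2}. C (Suc 2) = opposite (C 2) \<and> path_condition 0 C}"
    by (auto simp: path_condition_def neq_iff_opposite[symmetric] eval_nat_numeral)
  then have "path_count 1 =
      card {C \<in> colorings {1..Suc 2}. C (Suc 2) = opposite (C 2) \<and> path_condition 0 C}"
    unfolding path_count_def by (simp only:)
  also have "\<dots> = card {C \<in> colorings {1..2}. path_condition 0 C}"
    by (rule card_forced_last_color, rule path_condition_cong) auto
  also have "\<dots> = 2"
    using path_count_0 unfolding path_count_def by (simp only: add_0)
  finally show ?thesis .
qed

lemma path_count_rec: "path_count (m + 2) = path_count (m + 1) + path_count m"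
proof -
  let ?Q = "\<lambda>C. C (m + 3) = C (m + 2) \<and> path_condition m C"
  let ?A = "{C \<in> colorings {1..Suc (m + 3)}. C (Suc (m + 3)) = opposite (C (m + 3)) \<and>
    path_condition (m + 1) C}"
  let ?B = "{C \<in> colorings {1..Suc (m + 3)}. C (Suc (m + 3)) = opposite (C (m + 3)) \<and> ?Q C}"
  have "{C \<in> colorings {1..m + 2 + 2}. path_condition (m + 2) C} = ?A \<union> ?B"
    unfolding path_condition_rec by (auto simp: eval_nat_numeral)
  moreover have "?A \<inter> ?B = {}"
    by (auto simp: path_condition_def eval_nat_numeral)
  moreover have "finite ?A" "finite ?B"
    by (simp_all add: finite_colorings)
  ultimately have "path_count (m + 2) = card ?A + card ?B"
    unfolding path_count_def by (simp only: card_Un_disjoint)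
  moreover have "card ?A = path_count (m + 1)"
  proof -
    have "card ?A = card {C \<in> colorings {1..m + 3}. path_condition (m + 1) C}"
      by (rule card_forced_last_color, rule path_condition_cong) auto
    then show ?thesis
      by (simp add: path_count_def eval_nat_numeral)
  qed
  moreover have "card ?B = path_count m"
  proof -
    have "card ?B = card {C \<in> colorings {1..m + 3}. ?Q C}"
    proof (rule card_forced_last_color)
      fix C D :: "nat \<Rightarrow> color"
      assume eq: "\<And>v. v \<in> {1..m + 3} \<Longrightarrow> C v = D v"
      then have "path_condition m C \<longleftrightarrow> path_condition m D"
        by (intro path_condition_cong) auto
      then show "?Q C \<longleftrightarrow> ?Q D"
        using eq by auto
    qed simp
    \<comment> \<open>Now vertex \<open>m + 3\<close> is last, and its color copies that of \<open>m + 2\<close>.\<close>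
    also have "\<dots> = card {C \<in> colorings {1..Suc (m + 2)}. C (Suc (m + 2)) = id (C (m + 2)) \<and>
        path_condition m C}"
      by (simp add: eval_nat_numeral)
    also have "\<dots> = card {C \<in> colorings {1..m + 2}. path_condition m C}"
      by (rule card_forced_last_color, rule path_condition_cong) auto
    finally show ?thesis
      by (simp add: path_count_def)
  qed
  ultimately show ?thesis
    by simp
qed

lemma path_count_eq_fib: "path_count m = 2 * fib (m + 1)"
proof (induction m rule: fib.induct)
  case 1
  show ?case by (simp add: path_count_0)
next
  case 2
  show ?case using path_count_1 by simp
next
  case (3 m)
  then show ?case using path_count_rec[of m] by simp
qed

theorem theorem3:
  shows "ic (path_verts 1) (path_edges 1) = 2 \<and>
    (\<forall>n::nat. n \<ge> 2 \<longrightarrow> ic (path_verts n) (path_edges n) = 2 * fib (n - 1))"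
proof (intro conjI allI impI)
  show "ic (path_verts 1) (path_edges 1) = 2"
    by (rule ic_path_1)
  fix n :: nat
  assume "n \<ge> 2"
  then obtain m where "n = m + 2"
    by (metis add.commute le_Suc_ex)
  then show "ic (path_verts n) (path_edges n) = 2 * fib (n - 1)"
    using ic_path_eq[of m] path_count_eq_fib[of m] by simp
qed

end
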